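(* Let $K$ be a field of characteristic $p\ge 0$. The triples of polynomials $f,g,h\in K[x]$ with $f\circ g=h\circ f$ and $\deg(g)=\deg(h)=1\le\deg(f)$ are exactly those of the following forms, where $u,v,\psi\in K[x]$ and $\deg(u)=\deg(v)=1$: (1) $f=u^{-1}\circ(x+\psi(x^p-x))\circ v^{-1}$, $g=v(v^{-1}(x)+1)$, and $h=u^{-1}(u(x)+1)$, where if $p=0$ then $\psi\in K$; (2) $p>0$, $f=\psi(x^p-x)\circ v^{-1}$, $g=v(v^{-1}(x)+1)$, and $h=x$, where $\deg(\psi)>0$; (3) $f=u^{-1}\circ x^e\psi(x^s)\circ v^{-1}$, $g=v(\alpha v^{-1}(x))$, and $h=u^{-1}(\alpha^e u(x))$, where $e,s\in\mathbb{Z}_{\ge 0}$, $\alpha\in K^*$, $\alpha^s=1$, and $\deg(x^e\psi(x^s))>0$.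
   Context: $\circ$ denotes composition of polynomials; for a degree-one polynomial $u$, $u^{-1}$ denotes its compositional inverse (also a degree-one polynomial). *)

theory Defs
  imports "HOL-Computational_Algebra.Polynomial"
begin

abbreviation polyX :: "'a :: comm_semiring_1 poly"
  where "polyX \<equiv> [:0, 1:]"

text \<open>Compositional inverse. It is used only for polynomials of degree one, where it exists, is
  unique and is again of degree one; elsewhere the value may be unspecified.\<close>

definition compinv :: "'a :: field poly \<Rightarrow> 'a poly"
  where "compinv u = (THE w. u \<circ>\<^sub>p w = polyX \<and> w \<circ>\<^sub>p u = polyX)"

lemma compinv_linear:
  fixes a b :: "'a :: field"
  assumes "a \<noteq> 0"
  shows "compinv [:b, a:] = [:- b / a, 1 / a:]"
  unfolding compinv_def
proof (rule the_equality)
  show "[:b, a:] \<circ>\<^sub>p [:- b / a, 1 / a:] = polyX \<and> [:- b / a, 1 / a:] \<circ>\<^sub>p [:b, a:] = polyX"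
    using assms by (simp add: pcompose_pCons)
next
  fix w assume w: "[:b, a:] \<circ>\<^sub>p w = polyX \<and> w \<circ>\<^sub>p [:b, a:] = polyX"
  have "[:- b / a, 1 / a:] \<circ>\<^sub>p [:b, a:] = polyX"
    using assms by (simp add: pcompose_pCons)
  moreover have "polyX \<circ>\<^sub>p w = w"
    by (simp add: pcompose_pCons)
  ultimately have "w = [:- b / a, 1 / a:] \<circ>\<^sub>p ([:b, a:] \<circ>\<^sub>p w)"
    by (simp only: pcompose_assoc)
  also have "\<dots> = [:- b / a, 1 / a:]"
    using w by simp
  finally show "w = [:- b / a, 1 / a:]" .
qed

lemma compinv_degree_1:
  fixes u :: "'a :: field poly"
  assumes "degree u = 1"
  shows "degree (compinv u) = 1"
    and "u \<circ>\<^sub>p compinv u = polyX"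
    and "compinv u \<circ>\<^sub>p u = polyX"
proof -
  obtain a b where u: "u = [:b, a:]" and a: "a \<noteq> 0"
  proof
    show "u = [:coeff u 0, coeff u 1:]"
      using assms by (intro poly_eqI) (auto simp: coeff_pCons coeff_eq_0 split: nat.splits)
    show "coeff u 1 \<noteq> 0"
      using assms by (metis leading_coeff_0_iff degree_0 zero_neq_one)
  qed
  show "degree (compinv u) = 1" "u \<circ>\<^sub>p compinv u = polyX" "compinv u \<circ>\<^sub>p u = polyX"
    using a by (simp_all add: u compinv_linear pcompose_pCons)
qed

end

theory Submission
  imports Defs "HOL-Number_Theory.Cong"
begin

text \<open>Over any field a polynomial of degree one is conjugate either to \<open>x + 1\<close> or to
  \<open>\<alpha> x\<close>, so after changing coordinates on both sides one has to solve
  \<open>P \<circ> T = T' \<circ> P\<close> with \<open>T\<close> and \<open>T'\<close> of these two shapes. Each of the four combinations is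
  either impossible (look at the constant or the leading coefficient) or reduces to determining the
  polynomials \<open>F\<close> with \<open>F \<circ> T = F\<close>. Such an \<open>F\<close> is constant on the orbits of
  \<open>T\<close>. If \<open>T\<close> has an infinite orbit, \<open>F\<close> is constant. If some invariant \<open>q\<close> has degree at
  most the length of an orbit, then division by \<open>q\<close> leaves an invariant, hence constant, remainder
  and an invariant quotient, so by induction \<open>F\<close> is a polynomial in \<open>q\<close>.\<close>

subsection \<open>Polynomials invariant under a substitution\<close>

text \<open>A nonzero \<open>F - [:c:]\<close> would have more roots than its degree allows. The
  infinite case is a separate disjunct because \<open>card\<close> of an infinite set is 0.\<close>

lemma poly_eq_const_if_constant_on:
  fixes F :: "'a :: idom poly"
  assumes "\<And>z. z \<in> S \<Longrightarrow> poly F z = c" and "infinite S \<or> degree F < card S"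
  shows "F = [:c:]"
proof (rule ccontr)
  assume "F \<noteq> [:c:]"
  then have nz: "F - [:c:] \<noteq> 0" by simp
  have sub: "S \<subseteq> {z. poly (F - [:c:]) z = 0}"
    using assms(1) by auto
  have fin: "finite {z. poly (F - [:c:]) z = 0}"
    using poly_roots_finite[OF nz] .
  have "card S \<le> degree (F - [:c:])"
    using card_mono[OF fin sub] card_poly_roots_bound[OF nz] by linarith
  also have "\<dots> \<le> degree F"
    using degree_diff_le_max[of F "[:c:]"] by simp
  finally show False
    using assms(2) finite_subset[OF sub fin] by simp
qed

text \<open>The set \<open>S\<close> stands for an orbit, but it enters only through
  \<open>const\<close>, so that one induction serves translations and scalings alike;
  \<open>z0\<close> names the common value.\<close>

lemma pcompose_invariant_decompose:
  fixes F T q :: "'a :: field poly"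
  assumes T: "degree T = 1" and q: "q \<circ>\<^sub>p T = q" "degree q > 0" "degree q \<le> card S"
    and const: "\<And>G z. G \<circ>\<^sub>p T = G \<Longrightarrow> z \<in> S \<Longrightarrow> poly G z = poly G z0"
    and F: "F \<circ>\<^sub>p T = F"
  shows "\<exists>\<psi>. F = \<psi> \<circ>\<^sub>p q"
  using F
proof (induction "degree F" arbitrary: F rule: less_induct)
  case less
  define A R where "A = F div q" and "R = F mod q"
  have q0: "q \<noteq> 0" using q(2) by auto
  have FAR: "F = q * A + R" unfolding A_def R_def by simp
  have dR: "degree R < degree q"
    unfolding R_def using degree_mod_less'[OF q0, of F] q(2) by (cases "F mod q = 0") auto
  have dRT: "degree (R \<circ>\<^sub>p T) < degree q"
    using dR T by (simp add: degree_pcompose)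
  have "q * A + R = q * (A \<circ>\<^sub>p T) + R \<circ>\<^sub>p T"
    using less.prems q(1) by (subst (asm) (1 2) FAR) (simp add: pcompose_add pcompose_mult)
  then have eq: "q * (A - A \<circ>\<^sub>p T) = R \<circ>\<^sub>p T - R"
    by (simp add: algebra_simps)
  \<comment> \<open>Uniqueness of division with remainder: a nonzero left side of \<open>eq\<close>
    has degree at least \<open>degree q\<close>, whereas \<open>T\<close>, being linear, keeps the
    right side below it.\<close>
  have AT: "A \<circ>\<^sub>p T = A"
  proof (rule ccontr)
    assume "A \<circ>\<^sub>p T \<noteq> A"
    then have "degree q \<le> degree (q * (A - A \<circ>\<^sub>p T))"
      using q0 by (simp add: degree_mult_eq)
    also have "\<dots> < degree q"
      unfolding eq using dR dRT by (intro degree_diff_less)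
    finally show False by simp
  qed
  then have RT: "R \<circ>\<^sub>p T = R" using eq by simp
  have R: "R = [:poly R z0:]"
    using poly_eq_const_if_constant_on[of S R] const[OF RT] dR q(3) by auto
  show ?case
  proof (cases "A = 0")
    case True
    then show ?thesis
      using FAR R by (metis add_0 mult_zero_right pcompose_const)
  next
    case False
    have "degree (q * A + R) = degree q + degree A"
      using dR False q0 by (subst degree_add_eq_left) (auto simp: degree_mult_eq)
    then have "degree A < degree F" using FAR q(2) by simp
    then obtain \<psi> where "A = \<psi> \<circ>\<^sub>p q" using less.hyps AT by blast
    \<comment> \<open>Horner step: \<open>F\<close> is \<open>q * A\<close> plus a constant, so that
      constant is put in front of the coefficients found for \<open>A\<close>.\<close>
    then have "F = pCons (poly R z0) \<psi> \<circ>\<^sub>p q"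
      using FAR R by (simp add: pcompose_pCons add.commute)
    then show ?thesis by blast
  qed
qed

lemma pcompose_power: "(p ^ n) \<circ>\<^sub>p q = (p \<circ>\<^sub>p q) ^ n"
  for p q :: "'a :: comm_semiring_1 poly"
  by (induction n) (simp_all add: pcompose_1 pcompose_mult)

lemma pcompose_polyX: "polyX \<circ>\<^sub>p p = p"
  by (simp add: pcompose_pCons)

lemma polyX_power_scale: "polyX ^ n \<circ>\<^sub>p [:0, c:] = smult (c ^ n) (polyX ^ n)"
proof -
  have "[:0, c:] = smult c polyX" by simp
  then show ?thesis
    by (simp only: pcompose_power pcompose_idR smult_power pcompose_polyX)
qed

section \<open>Invariants of the translation x + 1\<close>

lemma poly_of_nat_if_translation_invariant:
  fixes F :: "'a :: comm_ring_1 poly"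
  assumes "F \<circ>\<^sub>p [:1, 1:] = F"
  shows "poly F (of_nat n) = poly F 0"
proof (induction n)
  case (Suc n)
  have "poly F (of_nat (Suc n)) = poly (F \<circ>\<^sub>p [:1, 1:]) (of_nat n)"
    by (simp add: poly_pcompose add.commute)
  then show ?case using Suc assms by simp
qed simp

lemma translation_invariant_char_0:
  fixes F :: "'a :: field poly"
  assumes "CHAR('a) = 0" and F: "F \<circ>\<^sub>p [:1, 1:] = F"
  shows "F = [:poly F 0:]"
proof (rule poly_eq_const_if_constant_on)
  \<comment> \<open>In characteristic 0 the orbit of 0 is infinite.\<close>
  have "inj (of_nat :: nat \<Rightarrow> 'a)"
    using assms(1) by (auto simp: inj_on_def of_nat_eq_iff_cong_CHAR cong_def)
  then show "infinite (range (of_nat :: nat \<Rightarrow> 'a)) \<or> degree F < card (range (of_nat :: nat \<Rightarrow> 'a))"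
    by (simp add: finite_image_iff)
qed (use poly_of_nat_if_translation_invariant[OF F] in auto)

text \<open>Frobenius is additive on K[x], so the shift adds 1 both to x^p and to x, and the two
  cancel in the difference.\<close>

lemma artin_schreier_translation_invariant:
  assumes "CHAR('a :: field) = p" "p > 0"
  shows "(polyX ^ p - polyX :: 'a poly) \<circ>\<^sub>p [:1, 1:] = polyX ^ p - polyX"
proof -
  have "prime CHAR('a poly)"
    using assms prime_CHAR_semidom[where 'a = 'a] by simp
  then have "(polyX + 1 :: 'a poly) ^ p = polyX ^ p + 1"
    using freshmans_dream[where x = "polyX :: 'a poly" and y = 1] assms(1) by simp
  moreover have "([:1, 1:] :: 'a poly) = polyX + 1" by (simp add: one_pCons)
  ultimately show ?thesis
    by (simp only: pcompose_diff pcompose_power pcompose_polyX add_diff_cancel_right)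
qed

lemma degree_artin_schreier:
  assumes "p > 1"
  shows "degree (polyX ^ p - polyX :: 'a :: field poly) = p"
  using assms unfolding diff_conv_add_uminus
  by (subst degree_add_eq_left) (simp_all add: degree_power_eq)

text \<open>The orbit of 0 is the prime field; its p elements match the degree of x^p - x
  exactly.\<close>

lemma translation_invariant_char_pos:
  fixes F :: "'a :: field poly"
  assumes p: "CHAR('a) = p" "p > 0" and F: "F \<circ>\<^sub>p [:1, 1:] = F"
  shows "\<exists>\<psi>. F = \<psi> \<circ>\<^sub>p (polyX ^ p - polyX)"
proof (rule pcompose_invariant_decompose[where T = "[:1, 1:]" and ?z0.0 = 0 and S = "of_nat ` {..<p}"])
  have "p > 1"
    using p prime_CHAR_semidom[where 'a = 'a] prime_gt_1_nat by auto
  have "inj_on (of_nat :: nat \<Rightarrow> 'a) {..<p}"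
    using p(1) by (auto simp: inj_on_def of_nat_eq_iff_cong_CHAR cong_def)
  then show "degree (polyX ^ p - polyX :: 'a poly) \<le> card (of_nat ` {..<p} :: 'a set)"
    using \<open>p > 1\<close> by (simp add: degree_artin_schreier card_image)
  show "degree (polyX ^ p - polyX :: 'a poly) > 0"
    using \<open>p > 1\<close> by (simp add: degree_artin_schreier)
qed (use p F artin_schreier_translation_invariant poly_of_nat_if_translation_invariant in auto)

section \<open>Invariants and semi-invariants of scalings\<close>

lemma scaling_invariant:
  fixes F :: "'a :: field poly"
  assumes \<alpha>: "\<alpha> \<noteq> 0" and F: "F \<circ>\<^sub>p [:0, \<alpha>:] = F"
  shows "\<exists>s \<psi>. \<alpha> ^ s = 1 \<and> F = \<psi> \<circ>\<^sub>p (polyX ^ s)"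
proof -
  have const: "poly G (\<alpha> ^ i) = poly G 1" if G: "G \<circ>\<^sub>p [:0, \<alpha>:] = G" for G i
  proof (induction i)
    case (Suc i)
    have "poly G (\<alpha> ^ Suc i) = poly (G \<circ>\<^sub>p [:0, \<alpha>:]) (\<alpha> ^ i)"
      by (simp add: poly_pcompose mult.commute)
    then show ?case using Suc G by simp
  qed simp
  have torsion: "\<alpha> ^ (j - i) = 1" if "i < j" "\<alpha> ^ i = \<alpha> ^ j" for i j
    using that \<alpha> power_add[of \<alpha> i "j - i"] by simp
  show ?thesis
  proof (cases "\<exists>s>0. \<alpha> ^ s = 1")
    case False
    then have "inj ((^) \<alpha>)"
      using torsion by (metis linorder_inj_onI' zero_less_diff)
    then have "infinite (range ((^) \<alpha>))"
      by (simp add: finite_image_iff)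
    then have "F = [:poly F 1:]"
      by (intro poly_eq_const_if_constant_on[of "range ((^) \<alpha>)"]) (auto simp: const[OF F])
    \<comment> \<open>A constant is covered by s = 0, where \<alpha>^0 = 1 and x^0 = 1.\<close>
    then show ?thesis
      by (metis pcompose_const power_0)
  next
    case True
    define s where "s = (LEAST s. s > 0 \<and> \<alpha> ^ s = 1)"
    have s: "s > 0" "\<alpha> ^ s = 1"
      using LeastI_ex[OF True] by (auto simp: s_def)
    have min: "\<not> (0 < n \<and> \<alpha> ^ n = 1)" if "n < s" for n
      using that not_less_Least[of n] by (auto simp: s_def)
    \<comment> \<open>A coincidence would give a positive exponent below the order \<open>s\<close>
      that kills \<alpha>. Hence the orbit of 1 has as many elements as the degree of x^s.\<close>
    have "inj_on ((^) \<alpha>) {..<s}"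
      using torsion min by (intro linorder_inj_onI') (metis lessThan_iff less_imp_diff_less zero_less_diff)
    moreover have "(polyX ^ s) \<circ>\<^sub>p [:0, \<alpha>:] = polyX ^ s"
      using s(2) by (simp add: polyX_power_scale)
    ultimately have "\<exists>\<psi>. F = \<psi> \<circ>\<^sub>p (polyX ^ s)"
      using s(1) \<alpha> F const
      by (intro pcompose_invariant_decompose[where T = "[:0, \<alpha>:]" and ?z0.0 = 1 and S = "(^) \<alpha> ` {..<s}"])
        (auto simp: degree_power_eq card_image)
    then show ?thesis using s(2) by blast
  qed
qed

text \<open>Split off the full power x^e dividing \<open>F\<close>. The cofactor has a nonzero
  constant term, which the scaling fixes; this forces \<beta> = \<alpha>^e and makes the cofactor
  invariant.\<close>

lemma scaling_semi_invariant:
  fixes F :: "'a :: field poly"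
  assumes \<alpha>: "\<alpha> \<noteq> 0" and F0: "F \<noteq> 0" and F: "F \<circ>\<^sub>p [:0, \<alpha>:] = smult \<beta> F"
  shows "\<exists>e s \<psi>. \<alpha> ^ s = 1 \<and> \<beta> = \<alpha> ^ e \<and> F = polyX ^ e * \<psi> \<circ>\<^sub>p (polyX ^ s)"
proof -
  obtain G where G: "F = polyX ^ order 0 F * G" and nd: "\<not> polyX dvd G"
    using order_decomp[OF F0, of 0] by auto
  define e where "e = order 0 F"
  have "polyX ^ e * smult (\<alpha> ^ e) (G \<circ>\<^sub>p [:0, \<alpha>:]) = polyX ^ e * smult \<beta> G"
    using F arg_cong[OF G[folded e_def], of "\<lambda>P. P \<circ>\<^sub>p [:0, \<alpha>:]"] G[folded e_def]
    by (simp only: pcompose_mult polyX_power_scale mult_smult_left mult_smult_right)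
  then have GT: "smult (\<alpha> ^ e) (G \<circ>\<^sub>p [:0, \<alpha>:]) = smult \<beta> G"
    by (simp flip: mult_smult_right)
  have "coeff G 0 \<noteq> 0"
    using nd poly_eq_0_iff_dvd[of G 0] by (simp add: poly_0_coeff_0)
  moreover have "\<alpha> ^ e * coeff G 0 = \<beta> * coeff G 0"
    using arg_cong[OF GT, of "\<lambda>P. coeff P 0"] by (simp add: poly_0_coeff_0)
  ultimately have \<beta>: "\<beta> = \<alpha> ^ e" by simp
  then have "G \<circ>\<^sub>p [:0, \<alpha>:] = G"
    using arg_cong[OF GT, of "smult (inverse (\<alpha> ^ e))"] \<alpha> by simp
  then obtain s \<psi> where "\<alpha> ^ s = 1" "G = \<psi> \<circ>\<^sub>p (polyX ^ s)"
    using scaling_invariant[OF \<alpha>] by blast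
  then show ?thesis using \<beta> G e_def by blast
qed

subsection \<open>Polynomials of degree one up to conjugation\<close>

lemma degree_1E:
  assumes "degree g = 1"
  obtains a b where "g = [:b, a:]" "a \<noteq> 0"
proof -
  obtain b q where g: "g = pCons b q" by (cases g)
  with assms have "q \<noteq> 0" "degree q = 0" by (auto simp: degree_pCons_eq_if split: if_splits)
  then obtain a where "q = [:a:]" "a \<noteq> 0" by (auto elim: degree_eq_zeroE)
  with g that show thesis by blast
qed

lemma compinv_compinv:
  assumes "degree u = 1"
  shows "compinv (compinv u) = u"
  using assms by (elim degree_1E) (simp add: compinv_linear)

lemma pcompose_1_1: "[:1, 1:] \<circ>\<^sub>p w = w + 1"
  by (simp add: pcompose_pCons one_pCons add.commute)

lemma pcompose_0_c: "[:0, c:] \<circ>\<^sub>p w = smult c w"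
  by (simp add: pcompose_pCons)

text \<open>A map x + b without fixed point becomes x + 1 when b is taken as the unit of length; any
  other linear map has a fixed point, and moving it to 0 leaves a scaling.\<close>

lemma linear_conjugate_cases:
  fixes g :: "'a :: field poly"
  assumes "degree g = 1"
  obtains (translation) v where "degree v = 1" "g = v \<circ>\<^sub>p [:1, 1:] \<circ>\<^sub>p compinv v"
    | (scaling) v \<alpha> where "degree v = 1" "\<alpha> \<noteq> 0" "g = v \<circ>\<^sub>p [:0, \<alpha>:] \<circ>\<^sub>p compinv v"
proof -
  obtain a b where g: "g = [:b, a:]" and a: "a \<noteq> 0"
    using assms by (rule degree_1E)
  show thesis
  proof (cases "a = 1 \<and> b \<noteq> 0")
    case True
    then show thesis
      using g by (intro translation[of "[:0, b:]"]) (auto simp: compinv_linear pcompose_pCons)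
  next
    case False
    \<comment> \<open>The fixed point of \<open>g\<close>. If a = 1, then b = 0 here and division by
      zero gives t = 0, a fixed point of the identity.\<close>
    define t where "t = b / (1 - a)"
    have "(1 - a) * t = b"
      using False by (cases "a = 1") (auto simp: t_def)
    then have "b = t - a * t"
      by (simp add: left_diff_distrib)
    then show thesis
      using a g compinv_linear[of 1 t]
      by (intro scaling[of "[:t, 1:]" a]) (auto simp: pcompose_pCons)
  qed
qed

lemma compinv_pcompose_cancel:
  assumes "degree u = 1"
  shows "compinv u \<circ>\<^sub>p (u \<circ>\<^sub>p w) = w" "u \<circ>\<^sub>p (compinv u \<circ>\<^sub>p w) = w"
  using compinv_degree_1[OF assms] by (simp_all add: pcompose_assoc pcompose_pCons)

text \<open>Adjacent inverse pairs cancel inside, and the remaining outer linear polynomials can be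
  cancelled on both sides.\<close>

lemma pcompose_conjugate_iff:
  fixes P T T' u v :: "'a :: field poly"
  assumes u: "degree u = 1" and v: "degree v = 1"
  shows "(compinv u \<circ>\<^sub>p P \<circ>\<^sub>p compinv v) \<circ>\<^sub>p (v \<circ>\<^sub>p T \<circ>\<^sub>p compinv v)
      = (compinv u \<circ>\<^sub>p T' \<circ>\<^sub>p u) \<circ>\<^sub>p (compinv u \<circ>\<^sub>p P \<circ>\<^sub>p compinv v) \<longleftrightarrow>
    P \<circ>\<^sub>p T = T' \<circ>\<^sub>p P" (is "?l = ?r \<longleftrightarrow> _")
proof -
  have "?l = compinv u \<circ>\<^sub>p ((P \<circ>\<^sub>p T) \<circ>\<^sub>p compinv v)"
    by (simp add: compinv_pcompose_cancel v flip: pcompose_assoc)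
  moreover have "?r = compinv u \<circ>\<^sub>p ((T' \<circ>\<^sub>p P) \<circ>\<^sub>p compinv v)"
    by (simp add: compinv_pcompose_cancel u flip: pcompose_assoc)
  moreover have "A = B" if "compinv u \<circ>\<^sub>p (A \<circ>\<^sub>p compinv v) = compinv u \<circ>\<^sub>p (B \<circ>\<^sub>p compinv v)" for A B
  proof -
    have "A \<circ>\<^sub>p compinv v \<circ>\<^sub>p v = B \<circ>\<^sub>p compinv v \<circ>\<^sub>p v"
      using that compinv_pcompose_cancel(2)[OF u] by metis
    then show ?thesis
      by (simp add: compinv_degree_1[OF v] flip: pcompose_assoc)
  qed
  ultimately show ?thesis by auto
qed

text \<open>Packaged for the converse direction, where each of the three families has this
  shape.\<close>

lemma pcompose_conjugate_commute:
  fixes P T T' u v :: "'a :: field poly"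
  assumes u: "degree u = 1" and v: "degree v = 1" and "degree T = 1" "degree T' = 1"
    and PT: "P \<circ>\<^sub>p T = T' \<circ>\<^sub>p P" and "degree P > 0"
    and f: "f = compinv u \<circ>\<^sub>p P \<circ>\<^sub>p compinv v"
    and g: "g = v \<circ>\<^sub>p T \<circ>\<^sub>p compinv v"
    and h: "h = compinv u \<circ>\<^sub>p T' \<circ>\<^sub>p u"
  shows "f \<circ>\<^sub>p g = h \<circ>\<^sub>p f \<and> degree g = 1 \<and> degree h = 1 \<and> 1 \<le> degree f"
  using assms(3,4,6) pcompose_conjugate_iff[OF u v, of P T T'] PT
    compinv_degree_1(1)[OF u] compinv_degree_1(1)[OF v] u v
  unfolding f g h by (simp add: degree_pcompose)

section \<open>The classification of the solutions\<close>

theorem theorem4p1: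
  fixes f g h :: "'a :: field poly" and p :: nat
  assumes "CHAR('a) = p"
  shows "(f \<circ>\<^sub>p g = h \<circ>\<^sub>p f \<and> degree g = 1 \<and> degree h = 1 \<and> 1 \<le> degree f) \<longleftrightarrow>
    (\<exists>u v \<psi>. degree u = 1 \<and> degree v = 1 \<and>
        f = compinv u \<circ>\<^sub>p (polyX + \<psi> \<circ>\<^sub>p (polyX ^ p - polyX)) \<circ>\<^sub>p compinv v \<and>
        g = v \<circ>\<^sub>p (compinv v + 1) \<and>
        h = compinv u \<circ>\<^sub>p (u + 1) \<and>
        (p = 0 \<longrightarrow> degree \<psi> = 0)) \<or>
    (\<exists>v \<psi>. degree v = 1 \<and>
        p > 0 \<and>
        f = \<psi> \<circ>\<^sub>p (polyX ^ p - polyX) \<circ>\<^sub>p compinv v \<and>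
        g = v \<circ>\<^sub>p (compinv v + 1) \<and>
        h = polyX \<and>
        degree \<psi> > 0) \<or>
    (\<exists>u v \<psi> (e :: nat) (s :: nat) (\<alpha> :: 'a). degree u = 1 \<and> degree v = 1 \<and>
        f = compinv u \<circ>\<^sub>p (polyX ^ e * \<psi> \<circ>\<^sub>p (polyX ^ s)) \<circ>\<^sub>p compinv v \<and>
        g = v \<circ>\<^sub>p smult \<alpha> (compinv v) \<and>
        h = compinv u \<circ>\<^sub>p smult (\<alpha> ^ e) u \<and>
        \<alpha> \<noteq> 0 \<and> \<alpha> ^ s = 1 \<and>
        degree (polyX ^ e * \<psi> \<circ>\<^sub>p (polyX ^ s)) > 0)"
  (is "_ \<longleftrightarrow> ?case1 \<or> ?case2 \<or> ?case3")
proof (intro iffI)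
  assume asm: "f \<circ>\<^sub>p g = h \<circ>\<^sub>p f \<and> degree g = 1 \<and> degree h = 1 \<and> 1 \<le> degree f"
  have change: "\<exists>P. f = compinv u \<circ>\<^sub>p P \<circ>\<^sub>p compinv v \<and> P \<circ>\<^sub>p T = T' \<circ>\<^sub>p P \<and> degree P > 0"
    if u: "degree u = 1" and v: "degree v = 1"
      and g: "g = v \<circ>\<^sub>p T \<circ>\<^sub>p compinv v" and h: "h = compinv u \<circ>\<^sub>p T' \<circ>\<^sub>p u" for u v T T'
  proof (intro exI conjI)
    show f: "f = compinv u \<circ>\<^sub>p (u \<circ>\<^sub>p f \<circ>\<^sub>p v) \<circ>\<^sub>p compinv v"
      by (simp add: compinv_pcompose_cancel u compinv_degree_1[OF v] flip: pcompose_assoc)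
    show "(u \<circ>\<^sub>p f \<circ>\<^sub>p v) \<circ>\<^sub>p T = T' \<circ>\<^sub>p (u \<circ>\<^sub>p f \<circ>\<^sub>p v)"
      using asm pcompose_conjugate_iff[OF u v, of "u \<circ>\<^sub>p f \<circ>\<^sub>p v" T T'] f g h by metis
    show "degree (u \<circ>\<^sub>p f \<circ>\<^sub>p v) > 0"
      using asm u v by (simp add: degree_pcompose)
  qed
  from asm have dg: "degree g = 1" and dh: "degree h = 1" by auto
  \<comment> \<open>The normal form of \<open>h\<close> has its inverse on the right; taking
    \<open>u\<close> as the inverse of that conjugator puts it on the left.\<close>
  from dh obtain u T' where u: "degree u = 1" and h: "h = compinv u \<circ>\<^sub>p T' \<circ>\<^sub>p u"
    and T': "T' = [:1, 1:] \<or> (\<exists>\<beta>. \<beta> \<noteq> 0 \<and> T' = [:0, \<beta>:])"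
    by (cases rule: linear_conjugate_cases) (metis compinv_compinv compinv_degree_1(1))+
  from dg show "?case1 \<or> ?case2 \<or> ?case3"
  proof (cases rule: linear_conjugate_cases)
    case (translation v)
    obtain P where f: "f = compinv u \<circ>\<^sub>p P \<circ>\<^sub>p compinv v" and PT: "P \<circ>\<^sub>p [:1, 1:] = T' \<circ>\<^sub>p P"
      and dP: "degree P > 0"
      using change[OF u translation h] by blast
    have g: "g = v \<circ>\<^sub>p (compinv v + 1)"
      using translation(2) by (simp add: pcompose_1_1 flip: pcompose_assoc)
    from T' show ?thesis
    proof (elim disjE exE conjE)
      assume T': "T' = [:1, 1:]"
      then have h': "h = compinv u \<circ>\<^sub>p (u + 1)"
        using h by (simp add: pcompose_1_1 flip: pcompose_assoc)
      \<comment> \<open>Now P(x + 1) = P(x) + 1, and x is a particular solution; the difference is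
        invariant.\<close>
      have inv: "(P - polyX) \<circ>\<^sub>p [:1, 1:] = P - polyX"
        using PT T' by (simp add: pcompose_diff pcompose_1_1) (simp add: pcompose_pCons one_pCons)
      have "\<exists>\<psi>. P - polyX = \<psi> \<circ>\<^sub>p (polyX ^ p - polyX) \<and> (p = 0 \<longrightarrow> degree \<psi> = 0)"
      proof (cases "p = 0")
        case True
        then have "P - polyX = [:poly (P - polyX) 0:]"
          using translation_invariant_char_0[OF _ inv] assms by simp
        then show ?thesis
          by (intro exI[of _ "[:poly (P - polyX) 0:]"]) simp
      qed (use translation_invariant_char_pos[OF assms _ inv] in auto)
      then obtain \<psi> where "P = polyX + \<psi> \<circ>\<^sub>p (polyX ^ p - polyX)" "p = 0 \<longrightarrow> degree \<psi> = 0"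
        by (metis add.commute diff_add_cancel)
      then have ?case1
        using u translation(1) f g h' by blast
      then show ?thesis ..
    next
      fix \<beta> assume T': "T' = [:0, \<beta>:]"
      \<comment> \<open>The translation preserves the leading coefficient, while \<open>T'\<close>
        multiplies it by \<beta>.\<close>
      have "lead_coeff (P \<circ>\<^sub>p [:1, 1:]) = lead_coeff P"
        by (simp add: lead_coeff_comp)
      moreover have "lead_coeff (P \<circ>\<^sub>p [:1, 1:]) = \<beta> * lead_coeff P"
        using PT by (simp add: T' pcompose_0_c lead_coeff_smult)
      ultimately have "\<beta> = 1" using dP by auto
      then have h': "h = polyX" and inv: "P \<circ>\<^sub>p [:1, 1:] = P"
        using h PT u by (auto simp: T' compinv_degree_1 pcompose_0_c)
      have "p > 0"
      proof (rule ccontr)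
        assume "\<not> p > 0"
        then have "P = [:poly P 0:]"
          using translation_invariant_char_0[OF _ inv] assms by simp
        then show False using dP by (metis degree_pCons_0 less_irrefl)
      qed
      then obtain \<psi> where \<psi>: "P = \<psi> \<circ>\<^sub>p (polyX ^ p - polyX)"
        using translation_invariant_char_pos[OF assms _ inv] by blast
      \<comment> \<open>The second family has no outer \<open>u\<close>, so \<open>compinv u\<close>
        is absorbed into \<psi>.\<close>
      have "degree (compinv u \<circ>\<^sub>p \<psi>) > 0"
        using dP compinv_degree_1(1)[OF u] by (simp add: \<psi> degree_pcompose)
      moreover have "f = (compinv u \<circ>\<^sub>p \<psi>) \<circ>\<^sub>p (polyX ^ p - polyX) \<circ>\<^sub>p compinv v"
        using f \<psi> by (simp add: pcompose_assoc)
      ultimately have ?case2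
        using translation(1) g h' \<open>p > 0\<close> by blast
      then show ?thesis by blast
    qed
  next
    case (scaling v \<alpha>)
    obtain P where f: "f = compinv u \<circ>\<^sub>p P \<circ>\<^sub>p compinv v" and PT: "P \<circ>\<^sub>p [:0, \<alpha>:] = T' \<circ>\<^sub>p P"
      and dP: "degree P > 0"
      using change[OF u scaling(1,3) h] by blast
    have g: "g = v \<circ>\<^sub>p smult \<alpha> (compinv v)"
      using scaling(3) by (simp add: pcompose_0_c flip: pcompose_assoc)
    from T' show ?thesis
    proof (elim disjE exE conjE)
      assume "T' = [:1, 1:]"
      \<comment> \<open>Impossible: evaluation at 0, the fixed point of the scaling, would give a
        fixed point of x + 1.\<close>
      then have "poly P 0 = poly P 0 + 1"
        using arg_cong[OF PT, of "\<lambda>Q. poly Q 0"] by (simp add: poly_pcompose)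
      then show ?thesis by simp
    next
      fix \<beta> assume T': "T' = [:0, \<beta>:]"
      obtain e s \<psi> where \<psi>: "\<alpha> ^ s = 1" "\<beta> = \<alpha> ^ e" "P = polyX ^ e * \<psi> \<circ>\<^sub>p (polyX ^ s)"
        using scaling_semi_invariant[OF scaling(2), of P \<beta>] PT[unfolded T' pcompose_0_c] dP
        by (metis degree_0 less_irrefl)
      then have "h = compinv u \<circ>\<^sub>p smult (\<alpha> ^ e) u"
        using h by (simp add: T' pcompose_0_c flip: pcompose_assoc)
      then have ?case3
        using u scaling(1,2) f g \<psi> dP by blast
      then show ?thesis by blast
    qed
  qed
next
  assume "?case1 \<or> ?case2 \<or> ?case3"
  then show "f \<circ>\<^sub>p g = h \<circ>\<^sub>p f \<and> degree g = 1 \<and> degree h = 1 \<and> 1 \<le> degree f"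
  proof (elim disjE exE conjE)
    fix u v \<psi>
    assume uv: "degree u = 1" "degree v = 1" and p: "p = 0 \<longrightarrow> degree \<psi> = 0"
      and f: "f = compinv u \<circ>\<^sub>p (polyX + \<psi> \<circ>\<^sub>p (polyX ^ p - polyX)) \<circ>\<^sub>p compinv v"
      and g: "g = v \<circ>\<^sub>p (compinv v + 1)" and h: "h = compinv u \<circ>\<^sub>p (u + 1)"
    define Q where "Q = \<psi> \<circ>\<^sub>p (polyX ^ p - polyX)"
    have inv: "Q \<circ>\<^sub>p [:1, 1:] = Q"
    proof (cases "p = 0")
      case True
      then show ?thesis using p by (auto simp: Q_def elim: degree_eq_zeroE)
    qed (simp add: Q_def artin_schreier_translation_invariant assms flip: pcompose_assoc)
    \<comment> \<open>The first family does not assume that \<open>f\<close> is nonconstant. If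
      \<psi> is nonconstant, the degree of \<open>Q\<close> is a multiple of p above 1, so
      \<open>Q\<close> cannot cancel x.\<close>
    have "degree (polyX + Q) > 0"
    proof (cases "degree \<psi> = 0")
      case True
      then show ?thesis by (auto simp: Q_def elim!: degree_eq_zeroE)
    next
      case False
      then have "p > 1"
        using p assms prime_CHAR_semidom[where 'a = 'a] prime_gt_1_nat by auto
      then have "degree Q > 1"
        using False less_1_mult'[of p "degree \<psi>", simplified]
        by (simp add: Q_def degree_pcompose degree_artin_schreier mult.commute[of _ p])
      then show ?thesis
        by (subst degree_add_eq_right) auto
    qed
    then show ?thesis
      using uv f inv
      by (intro pcompose_conjugate_commute[of u v "[:1, 1:]" "[:1, 1:]" "polyX + Q"])
        (auto simp: Q_def g h pcompose_1_1 pcompose_add pcompose_pCons add_ac one_pCons simp flip: pcompose_assoc)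
  next
    fix v \<psi>
    assume v: "degree v = 1" and p: "p > 0" and \<psi>: "degree \<psi> > 0"
      and f: "f = \<psi> \<circ>\<^sub>p (polyX ^ p - polyX) \<circ>\<^sub>p compinv v"
      and g: "g = v \<circ>\<^sub>p (compinv v + 1)" and h: "h = polyX"
    have "p > 1"
      using p assms prime_CHAR_semidom[where 'a = 'a] prime_gt_1_nat by auto
    then have "degree (\<psi> \<circ>\<^sub>p (polyX ^ p - polyX)) > 0"
      using \<psi> by (simp add: degree_pcompose degree_artin_schreier)
    \<comment> \<open>Here \<open>polyX\<close>, its own inverse, serves both as \<open>u\<close>
      and as \<open>T'\<close>.\<close>
    then show ?thesis
      using v f g h p compinv_linear[of "1 :: 'a" 0]
      by (intro pcompose_conjugate_commute[of polyX v "[:1, 1:]" polyX "\<psi> \<circ>\<^sub>p (polyX ^ p - polyX)"])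
        (auto simp: pcompose_1_1 pcompose_0_c artin_schreier_translation_invariant assms simp flip: pcompose_assoc)
  next
    fix u v \<psi> and e s :: nat and \<alpha> :: 'a
    assume uv: "degree u = 1" "degree v = 1" and \<alpha>: "\<alpha> \<noteq> 0" "\<alpha> ^ s = 1"
      and f: "f = compinv u \<circ>\<^sub>p (polyX ^ e * \<psi> \<circ>\<^sub>p (polyX ^ s)) \<circ>\<^sub>p compinv v"
      and g: "g = v \<circ>\<^sub>p smult \<alpha> (compinv v)" and h: "h = compinv u \<circ>\<^sub>p smult (\<alpha> ^ e) u"
      and d: "degree (polyX ^ e * \<psi> \<circ>\<^sub>p (polyX ^ s)) > 0"
    \<comment> \<open>The scaling fixes x^s because \<alpha>^s = 1, so only x^e contributes a
      factor.\<close>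
    have "(polyX ^ e * \<psi> \<circ>\<^sub>p (polyX ^ s)) \<circ>\<^sub>p [:0, \<alpha>:]
        = [:0, \<alpha> ^ e:] \<circ>\<^sub>p (polyX ^ e * \<psi> \<circ>\<^sub>p (polyX ^ s))"
      by (simp add: pcompose_0_c pcompose_mult polyX_power_scale \<alpha>(2) flip: pcompose_assoc)
    then show ?thesis
      using uv f g h d \<alpha>(1)
      by (intro pcompose_conjugate_commute[of u v "[:0, \<alpha>:]" "[:0, \<alpha> ^ e:]"
            "polyX ^ e * \<psi> \<circ>\<^sub>p (polyX ^ s)"])
        (auto simp: pcompose_0_c simp flip: pcompose_assoc)
  qed
qed

end
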